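(* Let $G_0,G_1\in\mathbb{Z}$ with $\gcd(G_0,G_1)=1$, and let $(G_n)_{n\ge0}$ satisfy $G_n=G_{n-1}+G_{n-2}$ for $n\ge2$. If $k$ is a positive integer with $k\equiv 2,6,10\pmod{12}$, then $$\gcd(G_{k+1}-G_1,\,G_{k+2}-G_2)=L_{k/2}.$$ In particular, $\mathcal{F}(k)=\mathcal{L}(k)=\mathcal{G}_{G_0,G_1}(k)=L_{k/2}$.
   Context: $L_n$ denotes the Lucas numbers ($L_0=2$, $L_1=1$, $L_n=L_{n-1}+L_{n-2}$). For a positive integer $k$, $\mathcal{G}_{G_0,G_1}(k)$ is the greatest common divisor of all integers $\sum_{i=0}^{k-1}G_{n+i}$, $n\ge1$; $\mathcal{F}(k)$ and $\mathcal{L}(k)$ denote this quantity for the Fibonacci sequence ($G_0=0,G_1=1$) and the Lucas sequence ($G_0=2,G_1=1$), respectively. *)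

theory Defs
  imports Complex_Main "HOL-Number_Theory.Fib"
begin

fun lucas :: "nat \<Rightarrow> int" where
  "lucas 0 = 2"
| "lucas (Suc 0) = 1"
| "lucas (Suc (Suc n)) = lucas (Suc n) + lucas n"

text \<open>
  \<open>consec_sum_gcd G k\<close> is the quantity written $\mathcal{G}_{G_0,G_1}(k)$ in the source.
  It takes the whole sequence as argument instead of its two initial values, which determine
  the sequence through the recurrence. The index $n$ starts at 1, and \<^const>\<open>Gcd\<close> is the
  nonnegative greatest common divisor of a possibly infinite set of integers.
\<close>

definition consec_sum_gcd :: "(nat \<Rightarrow> int) \<Rightarrow> nat \<Rightarrow> int" where
  "consec_sum_gcd G k = Gcd {\<Sum>i=0..<k. G (n + i) | n. n \<ge> 1}"

definition fib_sum_gcd :: "nat \<Rightarrow> int" where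
  "fib_sum_gcd k = consec_sum_gcd (\<lambda>n. int (fib n)) k"

definition lucas_sum_gcd :: "nat \<Rightarrow> int" where
  "lucas_sum_gcd k = consec_sum_gcd lucas k"

end

theory Submission
  imports Defs
begin

text \<open>
  For every sequence satisfying the Fibonacci recurrence,
  \<open>G (n + m) + (-1) ^ m * G (n - m) = L m * G n\<close>. As \<open>m = k div 2\<close> is odd, both
  \<open>G (n + k) - G n\<close> and the sums of \<open>k\<close> consecutive terms, which telescope to such differences,
  are \<open>L m\<close> times a term of the sequence. Consecutive terms stay coprime, so nothing else
  divides all of them.
\<close>

definition fib_recurrence :: "(nat \<Rightarrow> int) \<Rightarrow> bool" where
  "fib_recurrence G \<longleftrightarrow> (\<forall>n. G (Suc (Suc n)) = G (Suc n) + G n)"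

lemma fib_recurrenceD: "fib_recurrence G \<Longrightarrow> G (Suc (Suc n)) = G (Suc n) + G n"
  by (simp add: fib_recurrence_def)

lemma fib_recurrence_fib: "fib_recurrence (\<lambda>n. int (fib n))"
  by (simp add: fib_recurrence_def)

lemma fib_recurrence_lucas: "fib_recurrence lucas"
  by (simp add: fib_recurrence_def)

text \<open>An integer gcd is nonnegative, so a common factor leaves it as an absolute value;
  positivity removes the bars.\<close>

lemma lucas_pos: "lucas n > 0"
  by (induction n rule: lucas.induct) auto

text \<open>As functions of \<open>m\<close>, all three terms obey the Fibonacci recurrence: running
  \<open>G\<close> backwards turns it into a difference, and the alternating sign turns that into a
  sum again. \<open>m \<le> n\<close> keeps the subtraction untruncated.\<close>

lemma fib_recurrence_lucas_mult:
  assumes "fib_recurrence G" and "m \<le> n"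
  shows "G (n + m) + (-1) ^ m * G (n - m) = lucas m * G n"
  using \<open>m \<le> n\<close>
proof (induction m rule: lucas.induct)
  case 1
  then show ?case by simp
next
  case 2
  then obtain j where "n = Suc j" by (cases n) auto
  then show ?case using fib_recurrenceD[OF assms(1), of j] by simp
next
  case (3 m)
  then obtain j where n: "n = Suc (Suc (m + j))"
    by (metis add_Suc le_Suc_ex)
  have "G (Suc (Suc j)) = G (Suc j) + G j"
    and "G (Suc (Suc (n + m))) = G (Suc (n + m)) + G (n + m)"
    using fib_recurrenceD[OF assms(1)] by blast+
  moreover have "n - m = Suc (Suc j)" "n - Suc m = Suc j" "n - Suc (Suc m) = j"
    using n by simp_all
  ultimately show ?case using 3 by (simp add: algebra_simps)
qed

lemma fib_recurrence_diff:
  assumes "fib_recurrence G" and "odd m"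
  shows "G (n + 2 * m) - G n = lucas m * G (n + m)"
  \<comment> \<open>Centred at \<open>n + m\<close>, the outer indices are \<open>n + 2 * m\<close>
    and \<open>n\<close>; odd \<open>m\<close> makes the sign negative.\<close>
  using fib_recurrence_lucas_mult[OF assms(1), of m "n + m"] \<open>odd m\<close>
  by (simp add: mult_2 add.assoc)

lemma fib_recurrence_sum:
  assumes "fib_recurrence G"
  shows "(\<Sum>i=0..<k. G (n + i)) = G (Suc n + k) - G (Suc n)"
  by (induction k) (simp_all add: fib_recurrenceD[OF assms])

lemma fib_recurrence_coprime:
  assumes "fib_recurrence G" and "coprime (G 0) (G 1)"
  shows "coprime (G n) (G (Suc n))"
proof (induction n)
  case 0
  then show ?case using assms(2) by simp
next
  case (Suc n)
  then show ?case
    by (simp add: fib_recurrenceD[OF assms(1)] coprime_iff_gcd_eq_1 gcd.commute)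
qed

lemma consec_sum_gcd_eq_lucas:
  assumes "fib_recurrence G" and "coprime (G 0) (G 1)" and "odd m"
  shows "consec_sum_gcd G (2 * m) = lucas m"
proof -
  have sum: "(\<Sum>i=0..<2 * m. G (n + i)) = lucas m * G (Suc n + m)" for n
    using fib_recurrence_sum[OF assms(1)] fib_recurrence_diff[OF assms(1,3), of "Suc n"] by simp
  let ?A = "{\<Sum>i=0..<2 * m. G (n + i) | n. n \<ge> 1}"
  have "Gcd ?A = lucas m"
  proof (rule associated_eqI)
    show "lucas m dvd Gcd ?A"
      by (rule Gcd_greatest) (auto simp: sum)
    have "Gcd ?A dvd lucas m * G (Suc n + m)" if "n \<ge> 1" for n
      by (rule Gcd_dvd) (use that sum in fastforce)
    \<comment> \<open>The two smallest admissible \<open>n\<close> already give the coprime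
      neighbours \<open>G (m + 2)\<close> and \<open>G (m + 3)\<close>.\<close>
    from this[of 1] this[of 2]
    have "Gcd ?A dvd gcd (lucas m * G (m + 2)) (lucas m * G (Suc (m + 2)))"
      by (simp add: numeral_eq_Suc)
    also have "\<dots> = lucas m"
      using fib_recurrence_coprime[OF assms(1,2), of "m + 2"] lucas_pos[of m]
      by (simp add: gcd_mult_distrib_int[symmetric])
    finally show "Gcd ?A dvd lucas m" .
  qed (use lucas_pos[of m] in simp_all)
  then show ?thesis by (simp add: consec_sum_gcd_def)
qed

theorem theorem4p8:
  fixes G :: "nat \<Rightarrow> int" and k :: nat
  assumes "gcd (G 0) (G 1) = 1"
    and "\<And>n. n \<ge> 2 \<Longrightarrow> G n = G (n - 1) + G (n - 2)"
    and "k > 0"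
    and "k mod 12 \<in> {2, 6, 10}"
  shows "gcd (G (k + 1) - G 1) (G (k + 2) - G 2) = lucas (k div 2)
    \<and> fib_sum_gcd k = lucas (k div 2)
    \<and> lucas_sum_gcd k = lucas (k div 2)
    \<and> consec_sum_gcd G k = lucas (k div 2)"
proof -
  define m where "m = k div 2"
  \<comment> \<open>The residues 2, 6, 10 modulo 12 are exactly those congruent to 2 modulo 4, so
    \<open>k\<close> is twice an odd number.\<close>
  have k: "k = 2 * m" and "odd m"
    using assms(4) unfolding m_def by (auto, presburger+)
  have G: "fib_recurrence G"
    using assms(2)[of "Suc (Suc n)" for n] by (simp add: fib_recurrence_def)
  have cop: "coprime (G 0) (G 1)"
    using assms(1) by (simp add: coprime_iff_gcd_eq_1)
  have "gcd (G (k + 1) - G 1) (G (k + 2) - G 2)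
      = gcd (lucas m * G (m + 1)) (lucas m * G (Suc (m + 1)))"
    using fib_recurrence_diff[OF G \<open>odd m\<close>, of 1] fib_recurrence_diff[OF G \<open>odd m\<close>, of 2]
    by (simp add: k add.commute)
  also have "\<dots> = lucas m"
    using fib_recurrence_coprime[OF G cop, of "m + 1"] lucas_pos[of m]
    by (simp add: gcd_mult_distrib_int[symmetric])
  \<comment> \<open>The coprimality premises left open concern the initial pairs 0, 1 and 2,
    1.\<close>
  finally show ?thesis
    using consec_sum_gcd_eq_lucas[OF G cop \<open>odd m\<close>]
      consec_sum_gcd_eq_lucas[OF fib_recurrence_fib _ \<open>odd m\<close>]
      consec_sum_gcd_eq_lucas[OF fib_recurrence_lucas _ \<open>odd m\<close>]
    by (simp add: fib_sum_gcd_def lucas_sum_gcd_def k)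
qed

end
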